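(* Let $d\ge 1$ and let $\mathcal{F}$ be a family of nonempty compact convex sets in $\mathbb{R}^d$. If among every $\aleph_0$ members of $\mathcal{F}$ some $d+1$ are intersecting, then all the members of $\mathcal{F}$ can be hit by finitely many points, i.e., there is a finite set $P\subset\mathbb{R}^d$ with $P\cap K\neq\emptyset$ for all $K\in\mathcal{F}$.
   Context: Sets are intersecting if they all have a point in common. "Among every $\aleph_0$ members of $\mathcal{F}$ some $d+1$ are intersecting" means that every infinite subfamily of $\mathcal{F}$ contains $d+1$ distinct members with a common point (the condition is vacuous if $\mathcal{F}$ is finite). *)

theory Defs
  imports "HOL-Analysis.Analysis"
begin

end

(* Suppose F cannot be pierced by finitely many points. By induction on the dimension of an affine
   subspace L we extract a sequence of distinct members of F no dim L + 1 of which meet in L.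
   Refine F along a countable basis of open sets, keeping it unpierceable, so that the traces on L
   of its late members converge locally to a limit set inside L. If that limit set spans L, then
   late members all contain one common point of L, which is absurd. Otherwise it spans a proper
   affine subspace H, and every compact subset of L disjoint from H is missed by all late members.
   The induction hypothesis yields a sequence no dim L of whose members meet in H; the intersection
   of dim L members with L is compact and misses H, so it is avoided by all late members, and a
   sufficiently sparse subsequence has no dim L + 1 members meeting in L. *)

theory Submission
  imports Defs
begin

section \<open>Families pierced by finitely many points\<close>

definition pierceable :: "'a set set \<Rightarrow> bool"
  where "pierceable A \<longleftrightarrow> (\<exists>P. finite P \<and> (\<forall>K\<in>A. P \<inter> K \<noteq> {}))"

lemma pierceable_mono: "pierceable B \<Longrightarrow> A \<subseteq> B \<Longrightarrow> pierceable A"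
  unfolding pierceable_def by blast

lemma pierceable_empty [simp]: "pierceable {}"
  unfolding pierceable_def by blast

lemma pierceable_Un:
  assumes "pierceable A" "pierceable B"
  shows "pierceable (A \<union> B)"
proof -
  obtain P Q where "finite P" "\<forall>K\<in>A. P \<inter> K \<noteq> {}" "finite Q" "\<forall>K\<in>B. Q \<inter> K \<noteq> {}"
    using assms unfolding pierceable_def by blast
  then have "finite (P \<union> Q) \<and> (\<forall>K\<in>A \<union> B. (P \<union> Q) \<inter> K \<noteq> {})"
    by blast
  then show ?thesis
    unfolding pierceable_def by blast
qed

lemma pierceable_common_point: "(\<And>K. K \<in> A \<Longrightarrow> b \<in> K) \<Longrightarrow> pierceable A"
  unfolding pierceable_def by (rule exI[of _ "{b}"]) auto

lemma pierceable_finite: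
  assumes "finite A" "{} \<notin> A"
  shows "pierceable A"
proof -
  have "\<forall>K\<in>A. (\<lambda>K. SOME x. x \<in> K) ` A \<inter> K \<noteq> {}"
    using assms(2) by (metis IntI emptyE image_eqI some_in_eq)
  then show ?thesis
    unfolding pierceable_def using assms(1) by blast
qed

text \<open>Pierceable families are closed under subsets and finite unions, so when an unpierceable
  sequence is split by a predicate, one half remains unpierceable. The predicates are settled one
  after another; in the diagonal sequence \<open>A n \<inter> D n\<close>, the first
  \<open>n\<close> of them are decided.\<close>

lemma unpierceable_refinement:
  fixes A :: "nat \<Rightarrow> 'a set set" and Q :: "nat \<Rightarrow> 'a set \<Rightarrow> bool"
  assumes dec: "decseq A" and unp: "\<And>n. \<not> pierceable (A n)"
  obtains C where "decseq C" "\<And>n. C n \<subseteq> A n" "\<And>n. \<not> pierceable (C n)"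
    "\<And>i. (\<forall>K\<in>C (Suc i). Q i K) \<or> (\<forall>K\<in>C (Suc i). \<not> Q i K)"
proof -
  \<comment> \<open>Unpierceability is required inside every \<open>A n\<close> at once, so that a
    choice made for one predicate survives at all later indices.\<close>
  define \<Phi> where "\<Phi> D \<longleftrightarrow> (\<forall>n. \<not> pierceable (A n \<inter> D))" for D
  have split: "\<Phi> (D \<inter> E) \<or> \<Phi> (D - E)" if "\<Phi> D" for D E
  proof (rule ccontr)
    assume "\<not> ?thesis"
    then obtain m n where "pierceable (A m \<inter> (D \<inter> E))" "pierceable (A n \<inter> (D - E))"
      unfolding \<Phi>_def by blast
    then have "pierceable (A m \<inter> (D \<inter> E) \<union> A n \<inter> (D - E))"
      by (rule pierceable_Un)
    moreover have "A (max m n) \<subseteq> A m \<inter> A n"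
      using dec by (simp add: decseqD)
    ultimately have "pierceable (A (max m n) \<inter> D)"
      by (elim pierceable_mono) blast
    with that show False
      unfolding \<Phi>_def by blast
  qed
  define D where "D = rec_nat UNIV
    (\<lambda>i D. if \<Phi> (D \<inter> Collect (Q i)) then D \<inter> Collect (Q i) else D - Collect (Q i))"
  have D0: "D 0 = UNIV" and
    DSuc: "D (Suc i) = (if \<Phi> (D i \<inter> Collect (Q i)) then D i \<inter> Collect (Q i)
      else D i - Collect (Q i))" for i
    by (simp_all add: D_def)
  have \<Phi>D: "\<Phi> (D i)" for i
  proof (induction i)
    case 0
    show ?case by (simp add: D0 \<Phi>_def unp)
  next
    case (Suc i)
    then show ?case using split[OF Suc, of "Collect (Q i)"] by (auto simp: DSuc)
  qed
  show thesis
  proof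
    show "decseq (\<lambda>n. A n \<inter> D n)"
    proof (rule decseq_SucI)
      fix n
      have "A (Suc n) \<subseteq> A n"
        using dec by (simp add: decseqD)
      then show "A (Suc n) \<inter> D (Suc n) \<subseteq> A n \<inter> D n"
        by (auto simp: DSuc split: if_splits)
    qed
    show "\<not> pierceable (A n \<inter> D n)" for n
      using \<Phi>D unfolding \<Phi>_def by blast
    show "(\<forall>K\<in>A (Suc i) \<inter> D (Suc i). Q i K) \<or> (\<forall>K\<in>A (Suc i) \<inter> D (Suc i). \<not> Q i K)" for i
      by (auto simp: DSuc)
  qed blast
qed

section \<open>Convex sets close to a spanning set\<close>

text \<open>Take \<open>b\<close> in the relative interior of the hull of \<open>X\<close>, with a
  relative ball of radius \<open>e\<close> inside the hull. If \<open>C\<close> misses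
  \<open>b\<close>, moving from \<open>b\<close> by \<open>e\<close> straight away from
  \<open>C\<close> stays in the hull but ends more than \<open>e\<close> from \<open>C\<close>; yet
  the hull lies in the convex open \<open>e\<close>-neighbourhood of \<open>C\<close>. Both
  \<open>e\<close> and \<open>b\<close> depend on \<open>X\<close> only, so all such
  \<open>C\<close> share the point \<open>b\<close>.\<close>

lemma common_point_near_spanning_set:
  fixes X :: "'a::euclidean_space set"
  assumes "X \<noteq> {}"
  obtains e b where "e > 0"
    "\<And>C. \<lbrakk>convex C; closed C; C \<subseteq> affine hull X; \<And>x. x \<in> X \<Longrightarrow> \<exists>y\<in>C. dist x y < e\<rbrakk> \<Longrightarrow> b \<in> C"
proof -
  have "rel_interior (convex hull X) \<noteq> {}"
    using assms by (simp add: rel_interior_eq_empty)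
  then obtain b where "b \<in> rel_interior (convex hull X)"
    by blast
  then obtain e where b: "b \<in> convex hull X" and e: "e > 0"
    and sub: "cball b e \<inter> affine hull X \<subseteq> convex hull X"
    by (auto simp: mem_rel_interior_cball)
  show thesis
  proof
    show "e > 0" by fact
    fix C :: "'a set"
    assume C: "convex C" "closed C" "C \<subseteq> affine hull X"
      and near: "\<And>x. x \<in> X \<Longrightarrow> \<exists>y\<in>C. dist x y < e"
    show "b \<in> C"
    proof (rule ccontr)
      assume "b \<notin> C"
      have "C \<noteq> {}"
        using near assms by blast
      define p where "p = closest_point C b"
      have p: "p \<in> C"
        unfolding p_def using C \<open>C \<noteq> {}\<close> by (simp add: closest_point_in_set)
      have pos: "norm (p - b) > 0"
        using p \<open>b \<notin> C\<close> by auto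
      define u where "u = (1 / norm (p - b)) *\<^sub>R (p - b)"
      have u: "norm u = 1"
        using pos by (simp add: u_def)
      have "p \<in> affine hull X" "b \<in> affine hull X"
        using p C(3) b convex_hull_subset_affine_hull by blast+
      then have "b + (- e / norm (p - b)) *\<^sub>R (p - b) \<in> affine hull X"
        by (intro mem_affine_3_minus affine_affine_hull)
      then have w: "b - e *\<^sub>R u \<in> affine hull X"
        by (simp add: u_def)
      have "b - e *\<^sub>R u \<in> cball b e"
        using u e by (simp add: dist_norm)
      then have "b - e *\<^sub>R u \<in> convex hull X"
        using w sub by blast
      \<comment> \<open>The union is the Minkowski sum of \<open>C\<close> and the open ball of
        radius \<open>e\<close>.\<close>
      also have "convex hull X \<subseteq> (\<Union>y\<in>C. \<Union>z\<in>ball 0 e. {y + z})"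
      proof (rule hull_minimal)
        show "X \<subseteq> (\<Union>y\<in>C. \<Union>z\<in>ball 0 e. {y + z})"
        proof
          fix x assume "x \<in> X"
          then obtain y where "y \<in> C" "dist x y < e"
            using near by blast
          then have "x = y + (x - y)" "x - y \<in> ball 0 e"
            by (auto simp: dist_norm norm_minus_commute)
          with \<open>y \<in> C\<close> show "x \<in> (\<Union>y\<in>C. \<Union>z\<in>ball 0 e. {y + z})"
            by blast
        qed
        show "convex (\<Union>y\<in>C. \<Union>z\<in>ball 0 e. {y + z})"
          using C by (intro convex_sums convex_ball)
      qed
      finally obtain y z where y: "y \<in> C" and z: "norm z < e" and yz: "b - e *\<^sub>R u = y + z"
        by auto
      \<comment> \<open>At the nearest point \<open>p\<close>, the set \<open>C\<close> lies in the
        half-space facing away from \<open>b\<close>. In direction \<open>u\<close> this forces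
        \<open>0 \<le> - norm (p - b) - e - inner u z\<close>, impossible as
        \<open>norm z < e\<close>.\<close>
      have "inner (b - p) (y - p) \<le> 0"
        unfolding p_def using C y by (simp add: closest_point_dot)
      then have "inner u (y - p) \<ge> 0"
        by (simp add: u_def inner_diff_left divide_nonneg_nonneg)
      moreover have "inner u (p - b) = norm (p - b)"
        using pos by (simp add: u_def power2_norm_eq_inner[symmetric] power2_eq_square)
      moreover have "inner u u = 1"
        using u by (simp add: norm_eq_1)
      moreover have "y - p = - (p - b) - e *\<^sub>R u - z"
        using yz by (simp add: algebra_simps)
      ultimately have "- norm (p - b) - e - inner u z \<ge> 0"
        by (simp only: inner_diff_right inner_minus_right inner_scaleR_right mult_1_right)
      moreover have "\<bar>inner u z\<bar> \<le> norm z"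
        using Cauchy_Schwarz_ineq2[of u z] u by simp
      ultimately show False
        using z pos by linarith
    qed
  qed
qed

section \<open>Limit sets of unpierceable sequences\<close>

lemma unpierceable_concentrates:
  fixes L :: "'a::euclidean_space set"
  assumes L: "affine L" "L \<noteq> {}"
    and dec: "decseq A" and unp: "\<And>n. \<not> pierceable (A n)"
    and cc: "\<And>K. K \<in> A 0 \<Longrightarrow> compact K \<and> convex K"
  obtains C H where "decseq C" "\<And>n. C n \<subseteq> A n" "\<And>n. \<not> pierceable (C n)"
    "affine H" "H \<subseteq> L" "aff_dim H < aff_dim L"
    "\<And>T. \<lbrakk>compact T; T \<inter> H = {}\<rbrakk> \<Longrightarrow> \<exists>N. \<forall>K\<in>C N. K \<inter> L \<inter> T = {}"
proof -
  obtain \<B> :: "'a set set" where \<B>: "countable \<B>" "topological_basis \<B>"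
    using ex_countable_basis by blast
  have "\<B> \<noteq> {}"
    using topological_basisE[OF \<B>(2) open_UNIV UNIV_I] by blast
  define B where "B = from_nat_into \<B>"
  have B_open: "open (B i)" for i
    using \<B>(2) \<open>\<B> \<noteq> {}\<close> by (simp add: B_def from_nat_into topological_basis_open)
  have B_nbhd: "\<exists>i. x \<in> B i \<and> B i \<subseteq> U" if "open U" "x \<in> U" for x U
    using topological_basisE[OF \<B>(2) that] from_nat_into_surj[OF \<B>(1)] B_def by metis
  obtain C where C: "decseq C" "\<And>n. C n \<subseteq> A n" "\<And>n. \<not> pierceable (C n)"
    and decided: "\<And>i. (\<forall>K\<in>C (Suc i). K \<inter> L \<inter> B i \<noteq> {}) \<or> (\<forall>K\<in>C (Suc i). \<not> K \<inter> L \<inter> B i \<noteq> {})"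
    using unpierceable_refinement[OF dec unp, of "\<lambda>i K. K \<inter> L \<inter> B i \<noteq> {}"] by blast
  have C_ne: "C n \<noteq> {}" for n
    using C(3)[of n] by auto
  have C_mono: "C n \<subseteq> C m" if "m \<le> n" for m n
    using C(1) that by (simp add: decseqD)
  \<comment> \<open>\<open>M\<close> is the limit set of the traces on \<open>L\<close>. By
    \<open>decided\<close>, a point outside \<open>M\<close> has a basic neighbourhood missed by the
    traces of all late members. The space \<open>H\<close> is the affine hull of \<open>M\<close>,
    possibly empty.\<close>
  define M where "M = {x. \<forall>i. x \<in> B i \<longrightarrow> (\<forall>K\<in>C (Suc i). K \<inter> L \<inter> B i \<noteq> {})}"
  have near_M: "\<exists>n. \<forall>K\<in>C n. \<exists>y\<in>K \<inter> L. dist x y < e" if x: "x \<in> M" and e: "e > 0" for x e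
  proof -
    obtain i where i: "x \<in> B i" "B i \<subseteq> ball x e"
      using B_nbhd[of "ball x e" x] e by auto
    then have "\<forall>K\<in>C (Suc i). K \<inter> L \<inter> B i \<noteq> {}"
      using x unfolding M_def by blast
    then have "\<forall>K\<in>C (Suc i). \<exists>y\<in>K \<inter> L. dist x y < e"
      using i(2) by fastforce
    then show ?thesis ..
  qed
  have "M \<subseteq> L"
  proof
    fix x assume x: "x \<in> M"
    show "x \<in> L"
    proof (rule ccontr)
      assume "x \<notin> L"
      moreover have "open (- L)"
        using L affine_closed by blast
      ultimately obtain i where "x \<in> B i" "B i \<subseteq> - L"
        using B_nbhd[of "- L" x] by auto
      then show False
        using x C_ne[of "Suc i"] unfolding M_def by blast
    qed
  qed
  have HL: "affine hull M \<subseteq> L"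
    by (simp add: L(1) \<open>M \<subseteq> L\<close> hull_minimal)
  have "affine hull M \<noteq> L"
  proof
    assume span: "affine hull M = L"
    \<comment> \<open>An affine basis of the hull is finite, so one index \<open>N\<close> brings
      the traces within \<open>e\<close> of all its points simultaneously.\<close>
    obtain X where X: "X \<subseteq> M" "\<not> affine_dependent X" "affine hull M = affine hull X"
      using affine_basis_exists by blast
    have XL: "affine hull X = L"
      using X span by simp
    have "finite X" "X \<noteq> {}"
      using X XL L(2) aff_independent_finite by auto
    obtain e b where "e > 0" and b: "\<And>C. \<lbrakk>convex C; closed C; C \<subseteq> affine hull X;
        \<And>x. x \<in> X \<Longrightarrow> \<exists>y\<in>C. dist x y < e\<rbrakk> \<Longrightarrow> b \<in> C"
      using common_point_near_spanning_set[OF \<open>X \<noteq> {}\<close>] by blast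
    have "\<forall>x\<in>X. \<exists>n. \<forall>K\<in>C n. \<exists>y\<in>K \<inter> L. dist x y < e"
      using near_M X(1) \<open>e > 0\<close> by blast
    then obtain n where n: "\<And>x K. x \<in> X \<Longrightarrow> K \<in> C (n x) \<Longrightarrow> \<exists>y\<in>K \<inter> L. dist x y < e"
      by metis
    define N where "N = Max (n ` X)"
    have "b \<in> K" if K: "K \<in> C N" for K
    proof -
      have K0: "K \<in> A 0"
        using C(2)[of 0] C_mono[of 0 N] K by blast
      have "b \<in> K \<inter> L"
      proof (rule b)
        show "convex (K \<inter> L)" "closed (K \<inter> L)"
          using cc[OF K0] L by (auto simp: convex_Int affine_imp_convex compact_imp_closed
              affine_closed closed_Int)
        show "K \<inter> L \<subseteq> affine hull X"
          by (simp add: XL)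
        show "\<exists>y\<in>K \<inter> L. dist x y < e" if "x \<in> X" for x
        proof (rule n[OF that])
          have "n x \<le> N"
            using that \<open>finite X\<close> by (simp add: N_def)
          then show "K \<in> C (n x)"
            using K C_mono by blast
        qed
      qed
      then show ?thesis by blast
    qed
    then show False
      using pierceable_common_point[of "C N" b] C(3)[of N] by blast
  qed
  then have "affine hull M \<subset> affine hull L"
    using HL L(1) by (simp add: psubset_eq hull_same)
  then have dim: "aff_dim (affine hull M) < aff_dim L"
    by (simp add: aff_dim_psubset)
  have miss: "\<exists>N. \<forall>K\<in>C N. K \<inter> L \<inter> T = {}" if T: "compact T" "T \<inter> affine hull M = {}" for T
  proof -
    \<comment> \<open>These are the basic sets decided negatively. They cover \<open>T\<close>, and
      by compactness finitely many suffice, which bounds the index needed.\<close>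
    define I where "I = {i. \<forall>K\<in>C (Suc i). K \<inter> L \<inter> B i = {}}"
    have "T \<subseteq> (\<Union>i\<in>I. B i)"
    proof
      fix x assume "x \<in> T"
      then have "x \<notin> M"
        using T(2) hull_subset[of M affine] by blast
      then show "x \<in> (\<Union>i\<in>I. B i)"
        using decided unfolding M_def I_def by blast
    qed
    then obtain J where J: "J \<subseteq> I" "finite J" "T \<subseteq> (\<Union>i\<in>J. B i)"
      using compactE_image[OF T(1), of I B] B_open by blast
    obtain N where N: "\<And>i. i \<in> J \<Longrightarrow> Suc i \<le> N"
      using J(2) by (metis finite_nat_set_iff_bounded Suc_leI)
    have "K \<inter> L \<inter> T = {}" if K: "K \<in> C N" for K
    proof -
      have "K \<inter> L \<inter> B i = {}" if "i \<in> J" for i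
        using that J(1) C_mono[OF N[OF that]] K unfolding I_def by blast
      then show ?thesis
        using J(3) by blast
    qed
    then show ?thesis by blast
  qed
  show thesis
    using that[OF C affine_affine_hull HL dim miss] .
qed

section \<open>Extraction of sparse sequences\<close>

lemma inj_choice:
  fixes A :: "nat \<Rightarrow> 'b set"
  assumes "\<And>n. infinite (A n)"
  obtains G where "inj G" "\<And>n. G n \<in> A n"
proof -
  have "\<exists>G. \<forall>n. G n \<in> A n \<and> G n \<notin> G ` {..<n}"
  proof (rule dependent_wellorder_choice)
    fix x :: nat and G :: "nat \<Rightarrow> 'b"
    have "infinite (A x - G ` {..<x})"
      using assms by simp
    then show "\<exists>r. r \<in> A x \<and> r \<notin> G ` {..<x}"
      by (metis DiffE ex_in_conv finite.emptyI)
  next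
    fix r and f g :: "nat \<Rightarrow> 'b" and x :: nat
    assume "\<And>y. y < x \<Longrightarrow> f y = g y"
    then have "f ` {..<x} = g ` {..<x}"
      by (intro image_cong) auto
    then show "(r \<in> A x \<and> r \<notin> f ` {..<x}) = (r \<in> A x \<and> r \<notin> g ` {..<x})"
      by simp
  qed
  then obtain G where G: "\<And>n. G n \<in> A n" "\<And>n. G n \<notin> G ` {..<n}"
    by blast
  have "G m \<noteq> G n" if "m < n" for m n
    using G(2)[of n] that by (metis image_eqI lessThan_iff)
  then have "inj G"
    by (metis injI linorder_neqE_nat)
  with G(1) show thesis
    using that by blast
qed

text \<open>Stating the claim for a decreasing sequence, with \<open>G n \<in> A n\<close>, lets the
  induction hypothesis be applied to the refinement \<open>C\<close>: late terms of the resulting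
  sequence are then late members of \<open>C\<close> and avoid compact sets off \<open>H\<close>.
  The measure is shifted by one because the empty space has dimension -1.\<close>

lemma unpierceable_sparse_sequence:
  fixes L :: "'a::euclidean_space set"
  assumes "affine L" "decseq A" "\<And>n. \<not> pierceable (A n)"
    and "\<And>K. K \<in> A 0 \<Longrightarrow> K \<noteq> {} \<and> compact K \<and> convex K"
  shows "\<exists>G. inj G \<and> (\<forall>n. G n \<in> A n) \<and>
    (\<forall>S. finite S \<and> int (card S) > aff_dim L \<longrightarrow> L \<inter> \<Inter>(G ` S) = {})"
  using assms
proof (induction "nat (aff_dim L + 1)" arbitrary: L A rule: less_induct)
  case less
  note L = less.prems(1) and dec = less.prems(2) and unp = less.prems(3) and cc = less.prems(4)
  show ?case
  proof (cases "L = {}")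
    case True
    \<comment> \<open>For empty \<open>L\<close> sparseness is trivial, and any injective choice of
      members will do.\<close>
    have "infinite (A n)" for n
    proof
      assume "finite (A n)"
      moreover have "A n \<subseteq> A 0"
        using dec by (simp add: decseqD)
      ultimately show False
        using pierceable_finite unp cc by blast
    qed
    then obtain G where "inj G" "\<And>n. G n \<in> A n"
      using inj_choice by blast
    with True show ?thesis
      by auto
  next
    case False
    have cc': "compact K \<and> convex K" if "K \<in> A 0" for K
      using cc that by blast
    obtain C H where C: "decseq C" "\<And>n. C n \<subseteq> A n" "\<And>n. \<not> pierceable (C n)"
      and H: "affine H" "H \<subseteq> L" "aff_dim H < aff_dim L"
      and miss: "\<And>T. \<lbrakk>compact T; T \<inter> H = {}\<rbrakk> \<Longrightarrow> \<exists>N. \<forall>K\<in>C N. K \<inter> L \<inter> T = {}"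
      using unpierceable_concentrates[OF L False dec unp cc'] by blast
    have smaller: "nat (aff_dim H + 1) < nat (aff_dim L + 1)"
      using H(3) aff_dim_geq[of H] by linarith
    have cc_C: "K \<noteq> {} \<and> compact K \<and> convex K" if "K \<in> C 0" for K
      using C(2)[of 0] cc[of K] that by blast
    obtain G where G: "inj G" "\<And>n. G n \<in> C n"
      and G_sparse: "\<And>S. finite S \<Longrightarrow> int (card S) > aff_dim H \<Longrightarrow> H \<inter> \<Inter>(G ` S) = {}"
      using less.hyps[OF smaller H(1) C(1,3) cc_C] by blast
    have G_cmp: "compact (G n)" for n
      using G(2)[of n] decseqD[OF C(1), of 0 n] cc_C by blast
    have avoid: "\<exists>N. \<forall>n\<ge>N. L \<inter> \<Inter>(G ` insert n S) = {}"
      if S: "finite S" "int (card S) \<ge> aff_dim L" for S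
    proof -
      have "compact (L \<inter> \<Inter>(G ` S))"
      proof (cases "S = {}")
        \<comment> \<open>The empty intersection is the whole space, so compactness must come from
          \<open>L\<close>: here \<open>0 \<ge> aff_dim L\<close> makes the nonempty
          \<open>L\<close> a single point.\<close>
        case True
        then have "aff_dim L = 0"
          using S \<open>L \<noteq> {}\<close> aff_dim_negative_iff[of L] by (simp del: aff_dim_negative_iff)
        then show ?thesis
          using True by (auto simp: aff_dim_eq_0)
      next
        case False
        then have "compact (\<Inter>(G ` S))"
          using G_cmp by (intro compact_Inter) auto
        then show ?thesis
          by (simp add: L closed_Int_compact affine_closed)
      qed
      moreover have "L \<inter> \<Inter>(G ` S) \<inter> H = {}"
        using G_sparse[OF S(1)] S(2) H(3) by auto
      ultimately obtain N where N: "\<forall>K\<in>C N. K \<inter> L \<inter> (L \<inter> \<Inter>(G ` S)) = {}"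
        using miss by blast
      have "L \<inter> \<Inter>(G ` insert n S) = {}" if "n \<ge> N" for n
      proof -
        have "G n \<in> C N"
          using G(2) decseqD[OF C(1) that] by blast
        then show ?thesis
          using N by auto
      qed
      then show ?thesis by blast
    qed
    \<comment> \<open>Only finitely many index sets lie in \<open>{..m}\<close>, so one threshold
      serves them all.\<close>
    have "\<exists>N. N > m \<and> (\<forall>S\<subseteq>{..m}. int (card S) \<ge> aff_dim L \<longrightarrow>
        (\<forall>n\<ge>N. L \<inter> \<Inter>(G ` insert n S) = {}))" for m
    proof -
      define good where "good S N \<longleftrightarrow> (int (card S) \<ge> aff_dim L \<longrightarrow>
          (\<forall>n\<ge>N. L \<inter> \<Inter>(G ` insert n S) = {}))" for S and N :: nat
      have "\<exists>N. good S N" if "S \<in> Pow {..m}" for S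
        using avoid[of S] finite_subset[of S "{..m}"] that unfolding good_def by blast
      then obtain N where N: "\<And>S. S \<in> Pow {..m} \<Longrightarrow> good S (N S)"
        by metis
      define M where "M = max (Suc m) (Max (N ` Pow {..m}))"
      have "good S M" if S: "S \<in> Pow {..m}" for S
      proof -
        have "N S \<le> Max (N ` Pow {..m})"
          using S by (intro Max_ge finite_imageI imageI) auto
        then have "N S \<le> M"
          by (simp add: M_def)
        then show ?thesis
          using N[OF S] unfolding good_def by (meson order_trans)
      qed
      moreover have "M > m"
        by (simp add: M_def)
      ultimately show ?thesis
        unfolding good_def by blast
    qed
    then obtain f where f_gt: "\<And>m. f m > m" and
      f_avoid: "\<And>m S n. \<lbrakk>S \<subseteq> {..m}; int (card S) \<ge> aff_dim L; n \<ge> f m\<rbrakk>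
        \<Longrightarrow> L \<inter> \<Inter>(G ` insert n S) = {}"
      by metis
    \<comment> \<open>Each index passes the threshold of its predecessor. Starting at
      \<open>f 0\<close> instead of \<open>0\<close> puts even the first term past a threshold, as
      needed when \<open>L\<close> is a point and \<open>S = {0}\<close>.\<close>
    define r where "r = (\<lambda>n. (f ^^ Suc n) 0)"
    have r: "r 0 = f 0" "\<And>n. r (Suc n) = f (r n)"
      by (simp_all add: r_def)
    have "strict_mono r"
      by (simp add: strict_mono_Suc_iff r(2) f_gt)
    have "L \<inter> \<Inter>((G \<circ> r) ` S) = {}" if S: "finite S" "int (card S) > aff_dim L" for S
    proof -
      have "S \<noteq> {}"
        using S False aff_dim_negative_iff[of L] by auto
      \<comment> \<open>Without its largest index, \<open>S\<close> still has at least
        \<open>aff_dim L\<close> elements, and \<open>r m\<close> lies beyond the threshold for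
        their images under \<open>r\<close>.\<close>
      define m where "m = Max S"
      have m: "m \<in> S"
        using S \<open>S \<noteq> {}\<close> by (simp add: m_def)
      have below: "i < m" if "i \<in> S - {m}" for i
        using that S(1) unfolding m_def by (intro le_neq_implies_less Max_ge) auto
      have "card (r ` (S - {m})) = card S - 1"
        using S(1) m \<open>strict_mono r\<close> by (simp add: card_image strict_mono_imp_inj_on)
      then have card: "int (card (r ` (S - {m}))) \<ge> aff_dim L"
        using S m by (simp add: card_gt_0_iff \<open>S \<noteq> {}\<close>)
      have "L \<inter> \<Inter>(G ` insert (r m) (r ` (S - {m}))) = {}"
      proof (cases m)
        case 0
        then have "r ` (S - {m}) \<subseteq> {..0}"
          using below by blast
        then show ?thesis
          using card 0 r(1) by (intro f_avoid) auto
      next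
        case (Suc k)
        have "r ` (S - {m}) \<subseteq> {..r k}"
        proof
          fix x assume "x \<in> r ` (S - {m})"
          then obtain i where "i \<in> S - {m}" "x = r i"
            by blast
          then show "x \<in> {..r k}"
            using below[of i] Suc \<open>strict_mono r\<close> by (simp add: strict_mono_less_eq)
        qed
        then show ?thesis
          using card Suc r(2) by (intro f_avoid) auto
      qed
      moreover have "G ` insert (r m) (r ` (S - {m})) = (G \<circ> r) ` S"
        using m by auto
      ultimately show ?thesis
        by (simp only:)
    qed
    moreover have "inj (G \<circ> r)"
      using G(1) \<open>strict_mono r\<close> by (simp add: inj_compose strict_mono_imp_inj_on)
    moreover have "(G \<circ> r) n \<in> A n" for n
    proof -
      have "A (r n) \<subseteq> A n"
        using dec \<open>strict_mono r\<close> by (simp add: decseqD strict_mono_imp_increasing)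
      then show ?thesis
        using G(2)[of "r n"] C(2)[of "r n"] by auto
    qed
    ultimately show ?thesis
      by blast
  qed
qed

theorem corollary5:
  fixes F :: "(real ^ 'n) set set"
  assumes "\<And>K. K \<in> F \<Longrightarrow> K \<noteq> {} \<and> compact K \<and> convex K"
    and "\<And>G. G \<subseteq> F \<Longrightarrow> infinite G \<Longrightarrow>
           \<exists>H. H \<subseteq> G \<and> finite H \<and> card H = CARD('n) + 1 \<and> \<Inter>H \<noteq> {}"
  shows "\<exists>P :: (real ^ 'n) set. finite P \<and> (\<forall>K\<in>F. P \<inter> K \<noteq> {})"
proof (rule ccontr)
  assume "\<not> ?thesis"
  then have "\<not> pierceable F"
    unfolding pierceable_def by blast
  then obtain G :: "nat \<Rightarrow> (real ^ 'n) set" where G: "inj G" "\<And>n. G n \<in> F"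
    and sparse: "\<And>S. finite S \<Longrightarrow> int (card S) > aff_dim (UNIV :: (real ^ 'n) set) \<Longrightarrow>
      UNIV \<inter> \<Inter>(G ` S) = {}"
    \<comment> \<open>The constant sequence \<open>F\<close> is used with \<open>L\<close> the whole
      space, of dimension \<open>CARD('n)\<close>.\<close>
    using unpierceable_sparse_sequence[OF affine_UNIV, of "\<lambda>n. F"] assms(1) by auto
  have "infinite (range G)"
    using G(1) by (simp add: finite_image_iff)
  then obtain H where H: "H \<subseteq> range G" "finite H" "card H = CARD('n) + 1" "\<Inter>H \<noteq> {}"
    using assms(2)[of "range G"] G(2) by blast
  then obtain S where S: "finite S" "H = G ` S"
    \<comment> \<open>\<open>H\<close> is pulled back to an index set, of the same size since
      \<open>G\<close> is injective.\<close>
    using finite_subset_image[OF H(2,1)] by blast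
  then have "card S = CARD('n) + 1"
    using H(3) G(1) card_image inj_on_subset by (metis subset_UNIV)
  then show False
    using sparse[OF S(1)] S(2) H(4) by simp
qed

end
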